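(* Let $f:\mathbb{R}^n\to\mathbb{R}\cup\{\infty\}$ be convex and let $X\subset\operatorname{int}(\operatorname{dom} f)$ be closed and convex. Let $X^*=\operatorname{argmin}\{f(x)\mid x\in X\}$ be nonempty and bounded, and let $f^*$ denote the optimal value. Let $\varphi\ge f^*$, let $0<\lambda_k\le\beta<2$ for all $k$, and let $\sum_{k=0}^\infty\lambda_k=\infty$. Let $(\nu_k)$ be a nonnegative sequence with $\sum_{k=0}^\infty\nu_k<\infty$. Let $(x^k)$, $(h^k)$ and $f_k=f(x^k)$ be generated by the dynamic step size infeasible-point subgradient algorithm (defined in the context), run with target value $\varphi$, parameters $(\lambda_k)$, accuracies $(\varepsilon_k)$ and some $\gamma\in(0,1)$, and put $$\overline{\varepsilon}_k=-\left(\frac{\lambda_k(f_k-\varphi)}{\|h^k\|}+d_{X^*}(x^k)\right)+\sqrt{\left(\frac{\lambda_k(f_k-\varphi)}{\|h^k\|}+d_{X^*}(x^k)\right)^2+\frac{\lambda_k(2-\lambda_k)(f_k-\varphi)^2}{\|h^k\|^2}}.$$ Suppose that the subgradients satisfy $0<\underline{H}\le\|h^k\|\le\overline{H}<\infty$ for constants $\underline H,\overline H$, and that $0\le\varepsilon_k\le\min\{\overline{\varepsilon}_k,\nu_k\}$ for all $k$. Then the following holds. (i) For any given $\delta>0$ there exists some index $K$ such that $f(x^K)\le\varphi+\delta$. (ii) If additionally $f(x^k)>\varphi$ for all $k$ and $\lambda_k\to0$, then $f_k\to\varphi$ for $k\to\infty$.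
   Context: $\|\cdot\|$ is the Euclidean norm; $d_Y(x)=\inf_{y\in Y}\|x-y\|$; $\operatorname{dom} f=\{x\mid f(x)<\infty\}$; $X$ is strictly contained in $\operatorname{int}(\operatorname{dom} f)$; $\partial f(x)=\{h\mid f(y)\ge f(x)+h^\top(y-x)\ \forall y\in\mathbb{R}^n\}$; $\mathcal{P}_X$ is the Euclidean projection onto $X$. For every $\varepsilon\ge0$, $\mathcal{P}_X^\varepsilon:\mathbb{R}^n\to\mathbb{R}^n$ is a map of which one assumes only $\|\mathcal{P}_X^\varepsilon(x)-\mathcal{P}_X(x)\|\le\varepsilon$ for all $x$. Dynamic step size infeasible-point subgradient algorithm. Input: $\varphi\in\mathbb{R}$, a starting point $x^0$, sequences $(\lambda_k)$, $(\varepsilon_k)$, and $\gamma\in(0,1)$. Initialize $k:=0$, $\ell:=-1$, $x^{-1}:=x^0$, $h^{-1}:=0$, $\alpha_{-1}:=0$, $\varepsilon_{-1}:=\varepsilon_0$. Then repeat: (1) choose $h^k\in\partial f(x^k)$ and set $f_k=f(x^k)$; (2) if $f_k\le\varphi$ or $h^k=0$: if $x^k\in X$, stop; otherwise set $\ell:=\ell+1$, replace $x^k$ by $\mathcal{P}_X^{\varepsilon}(x^{k-1}-\alpha_{k-1}h^{k-1})$ with $\varepsilon=\gamma^{\ell}\varepsilon_{k-1}$, and go back to (1) with the same $k$ (a "refinement phase"); (3) otherwise set $\alpha_k:=\lambda_k(f_k-\varphi)/\|h^k\|^2$, $x^{k+1}:=\mathcal{P}_X^{\varepsilon_k}(x^k-\alpha_kh^k)$,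 $\ell:=0$, $k:=k+1$, and go to (1). No other stopping criterion is used. It is assumed that all points generated lie in $\operatorname{dom} f$ and that subgradients exist there. In all formulas, $x^k,h^k,f_k$ denote the final values for index $k$, after a possible refinement phase at $k$ has ended; the conditions on $\|h^k\|$ apply to all subgradients chosen by the algorithm, and the conditions on $\varepsilon_k$ to all indices $k$ for which step (3) is reached. If the algorithm stops at index $k$, then $x^k$ in (i) is the point at which it stops; if the refinement phase at index $k$ never ends, $x^k$ in (i) may be taken to be any of the points examined at index $k$. In (ii), the algorithm does not stop and every refinement phase is finite, so $(x^k)$ is infinite. *)

theory Defs
  imports "HOL-Analysis.Analysis"
begin

text \<open>Functions into the reals extended by plus infinity are modelled as \<open>ereal\<close>-valued
  functions that avoid \<open>-\<infinity>\<close>. In \<open>ereal\<close> one has \<open>0 * \<infinity> = 0\<close>, so the end points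
  \<open>t = 0\<close> and \<open>t = 1\<close> are harmless below.\<close>

definition ext_convex :: "('a::real_vector \<Rightarrow> ereal) \<Rightarrow> bool" where
  "ext_convex f \<longleftrightarrow> (\<forall>x. f x \<noteq> - \<infinity>) \<and>
     (\<forall>x y. \<forall>t\<in>{0..1}. f ((1 - t) *\<^sub>R x + t *\<^sub>R y) \<le> ereal (1 - t) * f x + ereal t * f y)"

definition ext_dom :: "('a \<Rightarrow> ereal) \<Rightarrow> 'a set" where
  "ext_dom f = {x. f x < \<infinity>}"

definition subdifferential :: "('a::real_inner \<Rightarrow> ereal) \<Rightarrow> 'a \<Rightarrow> 'a set" where
  "subdifferential f x = {h. \<forall>y. f x + ereal (h \<bullet> (y - x)) \<le> f y}"

definition argmin_on :: "('a \<Rightarrow> ereal) \<Rightarrow> 'a set \<Rightarrow> 'a set" where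
  "argmin_on f X = {x. is_arg_min f (\<lambda>x. x \<in> X) x}"

text \<open>A family of maps that approximates the Euclidean projection onto \<open>X\<close>; nothing is
  assumed for negative accuracies.\<close>

definition approx_projection :: "'a::euclidean_space set \<Rightarrow> (real \<Rightarrow> 'a \<Rightarrow> 'a) \<Rightarrow> bool" where
  "approx_projection X P \<longleftrightarrow>
     (\<forall>\<epsilon>\<ge>0. \<forall>x. norm (P \<epsilon> x - closest_point X x) \<le> \<epsilon>)"

text \<open>The variables of the algorithm each time it is about to choose a subgradient: the index
  \<open>k\<close>, the counter \<open>\<ell>\<close>, the current point \<open>x\<^sup>k\<close>, and the (final) values of \<open>x\<close>, \<open>h\<close>,
  \<open>\<alpha>\<close>, \<open>\<epsilon>\<close> at index \<open>k - 1\<close>.\<close>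

record 'a sg_state =
  idx :: nat
  ell :: int
  xcur :: 'a
  xprev :: 'a
  hprev :: 'a
  alprev :: real
  epsprev :: real

definition sg_init :: "(nat \<Rightarrow> real) \<Rightarrow> 'a::zero \<Rightarrow> 'a sg_state" where
  "sg_init eps x0 = \<lparr>idx = 0, ell = -1, xcur = x0, xprev = x0, hprev = 0, alprev = 0,
     epsprev = eps 0\<rparr>"

definition at_target :: "('a::zero \<Rightarrow> ereal) \<Rightarrow> real \<Rightarrow> 'a \<Rightarrow> 'a \<Rightarrow> bool" where
  "at_target f \<phi> x h \<longleftrightarrow> f x \<le> ereal \<phi> \<or> h = 0"

definition sg_stops :: "('a::zero \<Rightarrow> ereal) \<Rightarrow> 'a set \<Rightarrow> real \<Rightarrow> 'a sg_state \<Rightarrow> 'a \<Rightarrow> bool" where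
  "sg_stops f X \<phi> s h \<longleftrightarrow> at_target f \<phi> (xcur s) h \<and> xcur s \<in> X"

text \<open>One refinement; the power is never negative, because \<open>\<ell>\<close> is at least \<open>-1\<close>.\<close>

definition sg_refine :: "(real \<Rightarrow> 'a \<Rightarrow> 'a) \<Rightarrow> real \<Rightarrow> 'a::real_vector sg_state \<Rightarrow> 'a sg_state" where
  "sg_refine P \<gamma> s =
     s\<lparr>ell := ell s + 1,
       xcur := P (\<gamma> powi (ell s + 1) * epsprev s) (xprev s - alprev s *\<^sub>R hprev s)\<rparr>"

definition sg_advance :: "('a::real_normed_vector \<Rightarrow> ereal) \<Rightarrow> (real \<Rightarrow> 'a \<Rightarrow> 'a) \<Rightarrow> real \<Rightarrow>
    (nat \<Rightarrow> real) \<Rightarrow> (nat \<Rightarrow> real) \<Rightarrow> 'a sg_state \<Rightarrow> 'a \<Rightarrow> 'a sg_state" where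
  "sg_advance f P \<phi> lam eps s h =
     (let k = idx s; x = xcur s;
          \<alpha> = lam k * (real_of_ereal (f x) - \<phi>) / (norm h)\<^sup>2
      in \<lparr>idx = k + 1, ell = 0, xcur = P (eps k) (x - \<alpha> *\<^sub>R h), xprev = x, hprev = h,
          alprev = \<alpha>, epsprev = eps k\<rparr>)"

definition sg_step :: "('a::real_normed_vector \<Rightarrow> ereal) \<Rightarrow> (real \<Rightarrow> 'a \<Rightarrow> 'a) \<Rightarrow> real \<Rightarrow>
    (nat \<Rightarrow> real) \<Rightarrow> (nat \<Rightarrow> real) \<Rightarrow> real \<Rightarrow> 'a sg_state \<Rightarrow> 'a \<Rightarrow> 'a sg_state" where
  "sg_step f P \<phi> lam eps \<gamma> s h =
     (if at_target f \<phi> (xcur s) h then sg_refine P \<gamma> s else sg_advance f P \<phi> lam eps s h)"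

text \<open>A run is a sequence of states \<open>s n\<close> with chosen subgradients \<open>g n\<close>, where \<open>n\<close> counts all
  examined points (so it is not the index \<open>k\<close> of the algorithm). Both sequences are total;
  only the entries with \<open>reached \<dots> n\<close>, i.e. up to and including the stopping time if there is
  one, belong to the run.\<close>

definition reached :: "('a::zero \<Rightarrow> ereal) \<Rightarrow> 'a set \<Rightarrow> real \<Rightarrow> (nat \<Rightarrow> 'a sg_state) \<Rightarrow>
    (nat \<Rightarrow> 'a) \<Rightarrow> nat \<Rightarrow> bool" where
  "reached f X \<phi> s g n \<longleftrightarrow> (\<forall>i<n. \<not> sg_stops f X \<phi> (s i) (g i))"

definition sg_run :: "('a::real_inner \<Rightarrow> ereal) \<Rightarrow> 'a set \<Rightarrow> (real \<Rightarrow> 'a \<Rightarrow> 'a) \<Rightarrow> real \<Rightarrow> 'a \<Rightarrow>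
    (nat \<Rightarrow> real) \<Rightarrow> (nat \<Rightarrow> real) \<Rightarrow> real \<Rightarrow> (nat \<Rightarrow> 'a sg_state) \<Rightarrow> (nat \<Rightarrow> 'a) \<Rightarrow> bool" where
  "sg_run f X P \<phi> x0 lam eps \<gamma> s g \<longleftrightarrow>
     s 0 = sg_init eps x0 \<and>
     (\<forall>n. reached f X \<phi> s g n \<longrightarrow>
        xcur (s n) \<in> ext_dom f \<and>
        g n \<in> subdifferential f (xcur (s n)) \<and>
        (\<not> sg_stops f X \<phi> (s n) (g n) \<longrightarrow>
           s (Suc n) = sg_step f P \<phi> lam eps \<gamma> (s n) (g n)))"

text \<open>The step size update is reached at index \<open>k\<close>, with final values \<open>x\<close> and \<open>h\<close> of
  \<open>x\<^sup>k\<close> and \<open>h\<^sup>k\<close>.\<close>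

definition updates_at :: "('a::zero \<Rightarrow> ereal) \<Rightarrow> 'a set \<Rightarrow> real \<Rightarrow> (nat \<Rightarrow> 'a sg_state) \<Rightarrow>
    (nat \<Rightarrow> 'a) \<Rightarrow> nat \<Rightarrow> 'a \<Rightarrow> 'a \<Rightarrow> bool" where
  "updates_at f X \<phi> s g k x h \<longleftrightarrow>
     (\<exists>n. reached f X \<phi> s g n \<and> idx (s n) = k \<and> xcur (s n) = x \<and> g n = h \<and>
        \<not> at_target f \<phi> x h)"

definition stops_at :: "('a::zero \<Rightarrow> ereal) \<Rightarrow> 'a set \<Rightarrow> real \<Rightarrow> (nat \<Rightarrow> 'a sg_state) \<Rightarrow>
    (nat \<Rightarrow> 'a) \<Rightarrow> nat \<Rightarrow> 'a \<Rightarrow> bool" where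
  "stops_at f X \<phi> s g k x \<longleftrightarrow>
     (\<exists>n. reached f X \<phi> s g n \<and> idx (s n) = k \<and> xcur (s n) = x \<and> sg_stops f X \<phi> (s n) (g n))"

text \<open>The points that \<open>x\<^sup>k\<close> may denote: the final point at index \<open>k\<close> if there is one (then the
  set is a singleton), and every point examined at index \<open>k\<close> if the refinement phase there
  never ends. The set is empty iff index \<open>k\<close> is not attained.\<close>

definition iterates :: "('a::zero \<Rightarrow> ereal) \<Rightarrow> 'a set \<Rightarrow> real \<Rightarrow> (nat \<Rightarrow> 'a sg_state) \<Rightarrow>
    (nat \<Rightarrow> 'a) \<Rightarrow> nat \<Rightarrow> 'a set" where
  "iterates f X \<phi> s g k =
     (let fin = {x. stops_at f X \<phi> s g k x \<or> (\<exists>h. updates_at f X \<phi> s g k x h)}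
      in if fin \<noteq> {} then fin
         else {xcur (s n) |n. reached f X \<phi> s g n \<and> idx (s n) = k})"

definition eps_bar :: "('a::real_normed_vector \<Rightarrow> ereal) \<Rightarrow> 'a set \<Rightarrow> real \<Rightarrow> real \<Rightarrow> 'a \<Rightarrow> 'a \<Rightarrow> real"
  where
  "eps_bar f X \<phi> l x h =
     (let r = real_of_ereal (f x) - \<phi>;
          b = l * r / norm h + infdist x (argmin_on f X)
      in - b + sqrt (b\<^sup>2 + l * (2 - l) * r\<^sup>2 / (norm h)\<^sup>2))"

end

theory Submission
  imports Defs
begin

text \<open>Fix a minimiser \<open>z\<close> of \<open>f\<close> on \<open>X\<close> and put \<open>r\<^sub>k = f\<^sub>k - \<phi> > 0\<close>. Since the projection is
  nonexpansive, the step size rule gives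
  \<open>\<parallel>x\<^sup>k\<^sup>+\<^sup>1 - z\<parallel> \<le> sqrt (\<parallel>x\<^sup>k - z\<parallel>\<^sup>2 - \<lambda>\<^sub>k (2 - \<lambda>\<^sub>k) r\<^sub>k\<^sup>2 / \<parallel>h\<^sup>k\<parallel>\<^sup>2) + \<nu>\<^sub>k\<close>. Hence the distances to \<open>z\<close> are
  bounded, and squaring and telescoping shows that \<open>\<Sum> \<lambda>\<^sub>k r\<^sub>k\<^sup>2\<close> converges; as \<open>\<Sum> \<lambda>\<^sub>k\<close> diverges, \<open>r\<^sub>k\<close>
  cannot stay away from zero. Moreover the subgradient bound gives
  \<open>r\<^sub>k\<^sub>+\<^sub>1 - r\<^sub>k \<le> C (\<nu>\<^sub>k + \<nu>\<^sub>k\<^sub>-\<^sub>1 + \<lambda>\<^sub>k r\<^sub>k)\<close>. While \<open>r\<^sub>k \<ge> \<eta>\<close>, the last summand is at most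
  \<open>\<lambda>\<^sub>k r\<^sub>k\<^sup>2 / \<eta>\<close>, so these increments are summable and \<open>r\<^sub>k\<close> cannot climb back once it has been
  small.\<close>

section \<open>Convergence of the projected steps\<close>

text \<open>Expanding the square leaves a cross term, controlled by \<open>sub\<close>, and a
  quadratic term. The Polyak step \<open>a\<close> satisfies
  \<open>a * (norm h)\<^sup>2 = l * r\<close>, so the two combine to
  \<open>- 2 * a * r + a * (l * r)\<close>.\<close>

lemma polyak_step:
  fixes x h z :: "'a::real_inner"
  assumes "h \<noteq> 0" "0 \<le> l" "0 \<le> r" and sub: "r \<le> h \<bullet> (x - z)"
  shows "(norm (x - (l * r / (norm h)\<^sup>2) *\<^sub>R h - z))\<^sup>2
           \<le> (norm (x - z))\<^sup>2 - l * (2 - l) * r\<^sup>2 / (norm h)\<^sup>2"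
proof -
  define a where "a = l * r / (norm h)\<^sup>2"
  have a: "0 \<le> a" "a * (norm h)\<^sup>2 = l * r" using assms by (auto simp: a_def)
  have "x - a *\<^sub>R h - z = (x - z) - a *\<^sub>R h" by simp
  then have "(norm (x - a *\<^sub>R h - z))\<^sup>2
      = (norm (x - z))\<^sup>2 - 2 * a * (h \<bullet> (x - z)) + a * (a * (norm h)\<^sup>2)"
    by (simp only: power2_norm_eq_inner)
       (simp add: inner_diff inner_commute algebra_simps)
  also have "\<dots> \<le> (norm (x - z))\<^sup>2 - 2 * a * r + a * (l * r)"
    using mult_left_mono[OF sub a(1)] a(2) by simp
  also have "\<dots> = (norm (x - z))\<^sup>2 - l * (2 - l) * r\<^sup>2 / (norm h)\<^sup>2"
    by (simp add: a_def algebra_simps power2_eq_square add_divide_distrib diff_divide_distrib)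
  finally show ?thesis by (simp add: a_def)
qed

text \<open>A quasi-Fejer argument: the exact projection fixes \<open>z\<close> and is nonexpansive,
  so only the projection error can increase the distance to \<open>z\<close>. Summable errors keep
  that distance bounded, which makes their effect on the squared distance summable as well.\<close>

lemma summable_step_times_gap_squared:
  fixes x h :: "nat \<Rightarrow> 'a::euclidean_space"
  assumes X: "closed X" "convex X" "z \<in> X"
    and step: "\<And>k. norm (x (Suc k) - closest_point X (x k - (lam k * r k / (norm (h k))\<^sup>2) *\<^sub>R h k))
                      \<le> \<nu> k"
    and sub: "\<And>k. r k \<le> h k \<bullet> (x k - z)"
    and r: "\<And>k. 0 \<le> r k"
    and lam: "\<And>k. 0 \<le> lam k" "\<And>k. lam k \<le> \<beta>" "\<beta> < 2"
    and nu: "summable \<nu>"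
    and h: "\<And>k. h k \<noteq> 0" "\<And>k. norm (h k) \<le> Hup"
  shows "summable (\<lambda>k. lam k * (r k)\<^sup>2)"
proof -
  define d where "d k = norm (x k - z)" for k
  define y where "y k = x k - (lam k * r k / (norm (h k))\<^sup>2) *\<^sub>R h k" for k
  have nu0: "0 \<le> \<nu> k" for k using step[of k] norm_ge_zero order_trans by blast
  have d_y: "d (Suc k) \<le> norm (y k - z) + \<nu> k" for k
  proof -
    have "dist (closest_point X (y k)) (closest_point X z) \<le> dist (y k) z"
      using X by (intro closest_point_lipschitz) auto
    then have "norm (closest_point X (y k) - z) \<le> norm (y k - z)"
      using X by (simp add: closest_point_self dist_norm)
    moreover have "d (Suc k) \<le> norm (x (Suc k) - closest_point X (y k)) + norm (closest_point X (y k) - z)"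
      unfolding d_def by (rule norm_diff_triangle_le[OF order_refl order_refl])
    ultimately show ?thesis using step[of k] by (simp add: y_def)
  qed
  define D where "D k = lam k * (2 - lam k) * (r k)\<^sup>2 / (norm (h k))\<^sup>2" for k
  have D0: "0 \<le> D k" for k
    using lam(1)[of k] lam(2)[of k] lam(3) by (simp add: D_def)
  have y_d: "(norm (y k - z))\<^sup>2 \<le> (d k)\<^sup>2 - D k" for k
    unfolding y_def d_def D_def by (rule polyak_step[OF h(1) lam(1) r sub])
  have y_le: "norm (y k - z) \<le> d k" for k
  proof (rule power2_le_imp_le)
    show "(norm (y k - z))\<^sup>2 \<le> (d k)\<^sup>2" using y_d[of k] D0[of k] by linarith
  qed (simp add: d_def)
  have d_bd: "d k \<le> d 0 + (\<Sum>i<k. \<nu> i)" for k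
  proof (induction k)
    case (Suc k)
    then show ?case using d_y[of k] y_le[of k] by simp
  qed simp
  define V where "V = suminf \<nu>"
  have partial_le: "(\<Sum>i<k. \<nu> i) \<le> V" for k
    unfolding V_def using nu nu0 by (intro sum_le_suminf) auto
  define M where "M = d 0 + V"
  have dM: "d k \<le> M" for k using d_bd[of k] partial_le[of k] by (simp add: M_def)
  \<comment> \<open>The total error \<open>V\<close> also bounds every single error; this later
    replaces the square of \<open>\<nu> k\<close> by \<open>V * \<nu> k\<close>.\<close>
  have nuV: "\<nu> k \<le> V" for k
  proof -
    have "\<nu> k \<le> (\<Sum>i<Suc k. \<nu> i)" using nu0 by (simp add: sum_nonneg)
    then show ?thesis using partial_le order_trans by blast
  qed
  \<comment> \<open>After squaring, the bounds \<open>M\<close> on the distances and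
    \<open>V\<close> on the errors make all error terms linear in \<open>\<nu> k\<close>, with
    coefficient \<open>2 * M + V\<close>.\<close>
  have D_le: "D k \<le> (d k)\<^sup>2 - (d (Suc k))\<^sup>2 + (2 * M + V) * \<nu> k" for k
  proof -
    have "(d (Suc k))\<^sup>2 \<le> (norm (y k - z) + \<nu> k)\<^sup>2"
      using d_y by (intro power_mono) (auto simp: d_def)
    also have "\<dots> = (norm (y k - z))\<^sup>2 + 2 * norm (y k - z) * \<nu> k + \<nu> k * \<nu> k"
      by (simp add: power2_eq_square algebra_simps)
    also have "\<dots> \<le> ((d k)\<^sup>2 - D k) + 2 * M * \<nu> k + V * \<nu> k"
      using y_le[of k] dM[of k] nuV[of k] nu0[of k]
      by (intro add_mono y_d mult_right_mono) auto
    finally show ?thesis by (simp add: algebra_simps)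
  qed
  have "(\<Sum>k<n. D k) \<le> (d 0)\<^sup>2 + (2 * M + V) * V" for n
  proof -
    have MV: "0 \<le> 2 * M + V" using dM[of 0] nuV[of 0] nu0[of 0] by (simp add: d_def M_def)
    have "(\<Sum>k<n. D k) \<le> (\<Sum>k<n. (d k)\<^sup>2 - (d (Suc k))\<^sup>2) + (2 * M + V) * (\<Sum>k<n. \<nu> k)"
      unfolding sum_distrib_left sum.distrib[symmetric] by (intro sum_mono D_le)
    also have "(\<Sum>k<n. (d k)\<^sup>2 - (d (Suc k))\<^sup>2) = (d 0)\<^sup>2 - (d n)\<^sup>2"
      by (rule sum_lessThan_telescope')
    finally show ?thesis
      using mult_left_mono[OF partial_le[of n] MV] by (smt (verit) zero_le_power2)
  qed
  then have "summable D"
    by (intro bounded_imp_summable[where B = "(d 0)\<^sup>2 + (2 * M + V) * V"] D0)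
       (metis lessThan_Suc_atMost)
  then have "summable (\<lambda>k. (Hup\<^sup>2 / (2 - \<beta>)) * D k)" by (rule summable_mult)
  \<comment> \<open>\<open>D k\<close> is \<open>lam k * (r k)\<^sup>2\<close> times
    \<open>(2 - lam k) / (norm (h k))\<^sup>2\<close>, a factor that is at least
    \<open>(2 - \<beta>) / Hup\<^sup>2\<close>.\<close>
  moreover have "lam k * (r k)\<^sup>2 \<le> (Hup\<^sup>2 / (2 - \<beta>)) * D k" for k
  proof -
    have "(norm (h k))\<^sup>2 \<le> Hup\<^sup>2" using h(2) by (intro power_mono) auto
    then have "1 \<le> Hup\<^sup>2 / (norm (h k))\<^sup>2" using h(1)[of k] by (simp add: divide_simps)
    moreover have "1 \<le> (2 - lam k) / (2 - \<beta>)" using lam(2)[of k] lam(3) by (simp add: divide_simps)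
    ultimately have "1 * 1 \<le> (Hup\<^sup>2 / (norm (h k))\<^sup>2) * ((2 - lam k) / (2 - \<beta>))"
      by (intro mult_mono) auto
    then have "(lam k * (r k)\<^sup>2) * 1 \<le> (lam k * (r k)\<^sup>2) * ((Hup\<^sup>2 / (norm (h k))\<^sup>2) * ((2 - lam k) / (2 - \<beta>)))"
      using lam(1)[of k] by (intro mult_left_mono) auto
    then show ?thesis by (simp add: D_def mult_ac)
  qed
  ultimately show ?thesis
    using lam(1) by (elim summable_comparison_test'[where N = 0]) simp
qed

section \<open>From summability to vanishing gaps\<close>

text \<open>If \<open>r\<close> stayed above \<delta> from \<open>N\<close> on, comparison with the
  summable series would make \<open>lam\<close> itself summable, against \<open>div\<close>.\<close>

lemma frequently_small_of_summable_weighted_squares: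
  fixes lam r :: "nat \<Rightarrow> real"
  assumes div: "filterlim (\<lambda>m. \<Sum>k<m. lam k) at_top sequentially"
    and lam: "\<And>k. 0 \<le> lam k"
    and sm: "summable (\<lambda>k. lam k * (r k)\<^sup>2)"
    and "0 < \<delta>"
  shows "\<exists>k\<ge>N. r k < \<delta>"
proof (rule ccontr)
  assume "\<not> ?thesis"
  then have big: "\<delta> \<le> r k" if "N \<le> k" for k using that by (auto simp: not_less)
  have "summable (\<lambda>k. lam k * \<delta>\<^sup>2)"
    using big lam \<open>0 < \<delta>\<close>
    by (intro summable_comparison_test'[OF sm, where N = N]) (auto intro!: mult_left_mono power_mono)
  from summable_mult2[OF this, of "inverse (\<delta>\<^sup>2)"] have "summable lam"
    using \<open>0 < \<delta>\<close> by (simp add: mult.assoc)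
  then have "(\<lambda>m. \<Sum>k<m. lam k) \<longlonglongrightarrow> suminf lam" by (rule summable_LIMSEQ)
  then show False
    using not_tendsto_and_filterlim_at_infinity[OF sequentially_bot]
      filterlim_at_top_imp_at_infinity[OF div] by blast
qed

text \<open>Start at a late index where \<open>r\<close> is below a threshold \<eta>. From below the
  threshold a single step can overshoot it only slightly, because \<open>lam\<close> is small; above
  it, the increments are dominated by the tail of a convergent series.\<close>

lemma tendsto_zero_of_small_increments:
  fixes lam r c :: "nat \<Rightarrow> real"
  assumes inc: "\<And>k. r (Suc k) \<le> r k + c k + C * (lam k * r k)"
    and r: "\<And>k. 0 \<le> r k" and c: "\<And>k. 0 \<le> c k" "summable c" and C: "0 \<le> C"
    and lam: "\<And>k. 0 \<le> lam k" "lam \<longlonglongrightarrow> 0"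
    and sm: "summable (\<lambda>k. lam k * (r k)\<^sup>2)"
    and small: "\<And>\<delta> N. 0 < \<delta> \<Longrightarrow> \<exists>k\<ge>N. r k < \<delta>"
  shows "r \<longlonglongrightarrow> 0"
proof (rule LIMSEQ_I)
  fix \<epsilon> :: real assume "0 < \<epsilon>"
  \<comment> \<open>One third each pays for the threshold, the overshoot in one step, and the tail
    of \<open>a\<close>.\<close>
  define \<eta> where "\<eta> = \<epsilon> / 3"
  have \<eta>: "0 < \<eta>" using \<open>0 < \<epsilon>\<close> by (simp add: \<eta>_def)
  \<comment> \<open>This dominates the increment of \<open>r\<close> at \<open>k\<close> whenever
    \<open>r k\<close> is at least \<eta>, since then
    \<open>r k \<le> (r k)\<^sup>2 / \<eta>\<close>.\<close>
  define a where "a k = c k + (C / \<eta>) * (lam k * (r k)\<^sup>2)" for k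
  have a0: "0 \<le> a k" for k using c(1) C lam(1) \<eta> by (simp add: a_def)
  have "summable a" unfolding a_def by (intro summable_add summable_mult c sm)
  then obtain N1 where N1: "\<And>m n. N1 \<le> m \<Longrightarrow> norm (sum a {m..<n}) < \<eta>"
    using \<eta> unfolding summable_Cauchy by metis
  have "(\<lambda>k. C * lam k) \<longlonglongrightarrow> 0" using tendsto_mult_right_zero[OF lam(2)] by simp
  then have "\<forall>\<^sub>F k in sequentially. C * lam k < 1" by (rule order_tendstoD(2)) simp
  then obtain N2 where N2: "\<And>k. N2 \<le> k \<Longrightarrow> C * lam k < 1"
    unfolding eventually_sequentially by auto
  obtain K where K: "max N1 N2 \<le> K" "r K < \<eta>" using small[OF \<eta>] by blast
  have bound: "r (K + j) \<le> 2 * \<eta> + sum a {K..<K + j}" for j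
  proof (induction j)
    case 0
    show ?case using K \<eta> by simp
  next
    case (Suc j)
    define k where "k = K + j"
    have S: "sum a {K..<K + Suc j} = sum a {K..<k} + a k" by (simp add: k_def)
    \<comment> \<open>Below the threshold the bound is re-established from scratch, without the
      induction hypothesis; otherwise the hypothesis is extended by the summand
      \<open>a k\<close>.\<close>
    show ?case
    proof (cases "r k < \<eta>")
      case True
      have "C * lam k * r k \<le> 1 * \<eta>"
        using N2[of k] K True \<eta> r C lam(1) by (intro mult_mono) (auto simp: k_def)
      moreover have "c k \<le> a k" using C lam(1) \<eta> by (simp add: a_def)
      moreover have "0 \<le> sum a {K..<k}" using a0 by (simp add: sum_nonneg)
      ultimately show ?thesis using inc[of k] S True by (simp add: k_def mult_ac)
    next
      case False
      have "r k * 1 \<le> r k * (r k / \<eta>)"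
        using False \<eta> r by (intro mult_left_mono) (auto simp: divide_simps)
      then have "(C * lam k) * r k \<le> (C * lam k) * ((r k)\<^sup>2 / \<eta>)"
        using C lam(1) by (intro mult_left_mono) (auto simp: power2_eq_square)
      then have "c k + C * (lam k * r k) \<le> a k" by (simp add: a_def mult_ac)
      then show ?thesis using inc[of k] Suc S by (simp add: k_def)
    qed
  qed
  have "norm (r k - 0) < \<epsilon>" if "K \<le> k" for k
    using bound[of "k - K"] N1[of K k] K that r[of k] by (simp add: \<eta>_def)
  then show "\<exists>n0. \<forall>n\<ge>n0. norm (r n - 0) < \<epsilon>" by blast
qed

text \<open>The subgradient at the new point bounds the increase of the gap by \<open>Hup\<close>
  times the distance moved. Near \<open>X\<close> that distance is at most the step length plus
  projection errors, which supplies the increment condition for \<open>r\<close>.\<close>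

lemma projected_step_gap_tendsto_zero:
  fixes x h :: "nat \<Rightarrow> 'a::euclidean_space"
  assumes X: "closed X" "convex X" "z \<in> X"
    and step: "\<And>k. norm (x (Suc k) - closest_point X (x k - (lam k * r k / (norm (h k))\<^sup>2) *\<^sub>R h k))
                      \<le> \<nu> k"
    and sub: "\<And>k. r k \<le> h k \<bullet> (x k - z)"
    and sub_next: "\<And>k. r (Suc k) - r k \<le> h (Suc k) \<bullet> (x (Suc k) - x k)"
    and r: "\<And>k. 0 \<le> r k"
    and lam: "\<And>k. 0 \<le> lam k" "\<And>k. lam k \<le> \<beta>" "\<beta> < 2" "lam \<longlonglongrightarrow> 0"
    and div: "filterlim (\<lambda>m. \<Sum>k<m. lam k) at_top sequentially"
    and nu: "summable \<nu>"
    and h: "0 < Hlow" "\<And>k. Hlow \<le> norm (h k)" "\<And>k. norm (h k) \<le> Hup"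
  shows "r \<longlonglongrightarrow> 0"
proof -
  have h0: "h k \<noteq> 0" for k using h(1) h(2)[of k] by auto
  have Hup: "0 < Hup" using h(1) h(2)[of 0] h(3)[of 0] by linarith
  have nu0: "0 \<le> \<nu> k" for k using step[of k] norm_ge_zero order_trans by blast
  have sm: "summable (\<lambda>k. lam k * (r k)\<^sup>2)"
    by (rule summable_step_times_gap_squared[OF X step sub r lam(1,2,3) nu h0 h(3)])
  \<comment> \<open>The index is shifted by one: \<open>x 0\<close> may be far from
    \<open>X\<close>, whereas \<open>x (Suc k)\<close> lies within \<open>\<nu> k\<close> of
    \<open>X\<close>.\<close>
  have inc: "r (Suc (Suc k)) \<le> r (Suc k) + Hup * (\<nu> (Suc k) + \<nu> k)
                + Hup / Hlow * (lam (Suc k) * r (Suc k))" for k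
  proof -
    let ?k = "Suc k"
    define al where "al = lam ?k * r ?k / (norm (h ?k))\<^sup>2"
    let ?p = "closest_point X"
    have "norm (?p (x ?k - al *\<^sub>R h ?k) - ?p (x ?k)) \<le> norm (al *\<^sub>R h ?k)"
      using closest_point_lipschitz[OF X(2,1), of "x ?k - al *\<^sub>R h ?k" "x ?k"] X(3)
      by (auto simp: dist_norm)
    also have "\<dots> = lam ?k * r ?k / norm (h ?k)"
      using lam(1)[of ?k] r[of ?k] by (simp add: al_def power2_eq_square)
    also have "\<dots> \<le> lam ?k * r ?k / Hlow"
      using lam(1)[of ?k] r[of ?k] h(1) h(2)[of ?k] by (intro divide_left_mono mult_pos_pos) auto
    finally have 1: "norm (?p (x ?k - al *\<^sub>R h ?k) - ?p (x ?k)) \<le> lam ?k * r ?k / Hlow" .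
    \<comment> \<open>The previous exact projection belongs to \<open>X\<close>, so the nearest
      point of \<open>X\<close> is no farther away than it.\<close>
    have "dist (x ?k) (?p (x ?k)) \<le> dist (x ?k) (?p (x k - (lam k * r k / (norm (h k))\<^sup>2) *\<^sub>R h k))"
      using X by (intro closest_point_le closest_point_in_set) auto
    then have 2: "norm (?p (x ?k) - x ?k) \<le> \<nu> k"
      using step[of k] by (simp add: dist_norm norm_minus_commute)
    have 3: "norm (x (Suc ?k) - ?p (x ?k - al *\<^sub>R h ?k)) \<le> \<nu> ?k"
      using step[of ?k] by (simp add: al_def)
    have "norm ((x (Suc ?k) - ?p (x ?k - al *\<^sub>R h ?k))
        + (?p (x ?k - al *\<^sub>R h ?k) - ?p (x ?k)) + (?p (x ?k) - x ?k))
        \<le> \<nu> ?k + lam ?k * r ?k / Hlow + \<nu> k"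
      by (intro norm_triangle_le add_mono 1 2 3)
    then have "norm (x (Suc ?k) - x ?k) \<le> \<nu> ?k + lam ?k * r ?k / Hlow + \<nu> k"
      by simp
    then have "norm (h (Suc ?k)) * norm (x (Suc ?k) - x ?k)
        \<le> Hup * (\<nu> ?k + lam ?k * r ?k / Hlow + \<nu> k)"
      using h(3) Hup by (intro mult_mono) auto
    moreover have "r (Suc ?k) - r ?k \<le> norm (h (Suc ?k)) * norm (x (Suc ?k) - x ?k)"
      using sub_next[of ?k] norm_cauchy_schwarz order_trans by blast
    ultimately show ?thesis by (simp add: algebra_simps)
  qed
  have "(\<lambda>k. r (Suc k)) \<longlonglongrightarrow> 0"
  proof (rule tendsto_zero_of_small_increments[where lam = "\<lambda>k. lam (Suc k)"
        and c = "\<lambda>k. Hup * (\<nu> (Suc k) + \<nu> k)" and C = "Hup / Hlow"])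
    show "summable (\<lambda>k. Hup * (\<nu> (Suc k) + \<nu> k))"
      using nu by (intro summable_mult summable_add) (simp_all add: summable_Suc_iff)
    show "summable (\<lambda>k. lam (Suc k) * (r (Suc k))\<^sup>2)"
      using sm by (subst summable_Suc_iff[where f = "\<lambda>k. lam k * (r k)\<^sup>2"])
    show "(\<lambda>k. lam (Suc k)) \<longlonglongrightarrow> 0" using lam(4) by (rule LIMSEQ_Suc)
    show "\<exists>k\<ge>N. r (Suc k) < \<delta>" if \<delta>: "0 < \<delta>" for \<delta> N
    proof -
      obtain k where "Suc N \<le> k" "r k < \<delta>"
        using frequently_small_of_summable_weighted_squares[OF div lam(1) sm \<delta>] by blast
      then show ?thesis by (cases k) auto
    qed
  qed (use inc r nu0 Hup h(1) lam(1) in auto)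
  then show ?thesis by (rule LIMSEQ_imp_Suc)
qed

section \<open>Runs of the algorithm\<close>

lemma reached_antimono: "reached f X \<phi> s g n \<Longrightarrow> m \<le> n \<Longrightarrow> reached f X \<phi> s g m"
  by (auto simp: reached_def)

lemma sg_run_Suc:
  assumes "sg_run f X P \<phi> x0 lam eps \<gamma> s g" "reached f X \<phi> s g (Suc n)"
  shows "s (Suc n) = sg_step f P \<phi> lam eps \<gamma> (s n) (g n)"
  using assms unfolding sg_run_def reached_def by (meson lessI less_Suc_eq)

lemma idx_sg_step:
  "idx (sg_step f P \<phi> lam eps \<gamma> t h) = (if at_target f \<phi> (xcur t) h then idx t else Suc (idx t))"
  by (simp add: sg_step_def sg_refine_def sg_advance_def Let_def)

lemma idx_mono:
  assumes run: "sg_run f X P \<phi> x0 lam eps \<gamma> s g" and "reached f X \<phi> s g n" "m \<le> n"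
  shows "idx (s m) \<le> idx (s n)"
  using assms(3,2)
proof (induction rule: dec_induct)
  case (step n)
  then have "idx (s m) \<le> idx (s n)" using reached_antimono le_SucI by blast
  then show ?case using sg_run_Suc[OF run step.prems] by (simp add: idx_sg_step)
qed simp

lemma idx_less_after_update:
  assumes run: "sg_run f X P \<phi> x0 lam eps \<gamma> s g" and n: "reached f X \<phi> s g n" "m < n"
    and "\<not> at_target f \<phi> (xcur (s m)) (g m)"
  shows "idx (s m) < idx (s n)"
proof -
  have "reached f X \<phi> s g (Suc m)" using n reached_antimono Suc_leI by blast
  then have "idx (s (Suc m)) = Suc (idx (s m))"
    using sg_run_Suc[OF run] assms(4) by (simp add: idx_sg_step)
  then show ?thesis using idx_mono[OF run n(1)] n(2) by (metis Suc_le_eq)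
qed

text \<open>Each update raises the index for good, so two updates at the same index must happen at
  the same time. This justifies speaking of the final point and subgradient at
  \<open>k\<close>.\<close>

lemma updates_at_unique:
  assumes run: "sg_run f X P \<phi> x0 lam eps \<gamma> s g"
    and "updates_at f X \<phi> s g k x h" "updates_at f X \<phi> s g k x' h'"
  shows "x = x' \<and> h = h'"
proof -
  obtain m n where m: "reached f X \<phi> s g m" "idx (s m) = k" "xcur (s m) = x" "g m = h"
      "\<not> at_target f \<phi> x h"
    and n: "reached f X \<phi> s g n" "idx (s n) = k" "xcur (s n) = x'" "g n = h'"
      "\<not> at_target f \<phi> x' h'"
    using assms unfolding updates_at_def by blast
  have "\<not> m < n" "\<not> n < m"
    using idx_less_after_update[OF run n(1), of m] idx_less_after_update[OF run m(1), of n] m n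
    by auto
  then have "m = n" by simp
  then show ?thesis using m n by simp
qed

text \<open>An update before the stop would have left the index, nothing after the stop is reached,
  and at the time of the stop itself the target test holds.\<close>

lemma not_updates_at_if_stops_at:
  assumes run: "sg_run f X P \<phi> x0 lam eps \<gamma> s g" and "stops_at f X \<phi> s g k x"
  shows "\<not> updates_at f X \<phi> s g k x' h'"
proof
  assume "updates_at f X \<phi> s g k x' h'"
  then obtain m where m: "reached f X \<phi> s g m" "idx (s m) = k" "\<not> at_target f \<phi> (xcur (s m)) (g m)"
    unfolding updates_at_def by blast
  obtain n where n: "reached f X \<phi> s g n" "idx (s n) = k" "sg_stops f X \<phi> (s n) (g n)"
    using assms(2) unfolding stops_at_def by blast
  have "\<not> m < n" using idx_less_after_update[OF run n(1), of m] m n by auto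
  moreover have "\<not> n < m" using m(1) n(3) by (auto simp: reached_def)
  ultimately show False using m n by (auto simp: sg_stops_def)
qed

section \<open>Refinement phases and the link between consecutive indices\<close>

text \<open>A refinement repeats the projection of the same point, built from the stored values of
  the previous index, and only sharpens the accuracy. The exponent \<open>j\<close> is the value of
  \<open>ell\<close>: an update resets it to 0, matching accuracy \<open>eps k\<close>.\<close>

lemma xcur_eq_projection:
  assumes run: "sg_run f X P \<phi> x0 lam eps \<gamma> s g" and "reached f X \<phi> s g n" "idx (s n) = Suc k"
  shows "\<exists>x h (j::nat). updates_at f X \<phi> s g k x h \<and>
     xcur (s n) = P (\<gamma> ^ j * eps k)
       (x - (lam k * (real_of_ereal (f x) - \<phi>) / (norm h)\<^sup>2) *\<^sub>R h)"
proof -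
  \<comment> \<open>The induction carries the stored fields along, since the next refinement is
    computed from them.\<close>
  have "\<exists>x h (j::nat). updates_at f X \<phi> s g k x h \<and> ell (s n) = int j \<and> epsprev (s n) = eps k \<and>
     xprev (s n) = x \<and> hprev (s n) = h \<and>
     alprev (s n) = lam k * (real_of_ereal (f x) - \<phi>) / (norm h)\<^sup>2 \<and>
     xcur (s n) = P (\<gamma> ^ j * eps k) (x - alprev (s n) *\<^sub>R h)"
    using assms(2,3)
  proof (induction n)
    case 0
    then show ?case using run by (simp add: sg_run_def sg_init_def)
  next
    case (Suc n)
    have n: "reached f X \<phi> s g n" using Suc.prems reached_antimono le_SucI by blast
    note eq = sg_run_Suc[OF run Suc.prems(1)]
    show ?case
    proof (cases "at_target f \<phi> (xcur (s n)) (g n)")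
      case True
      then have s: "s (Suc n) = sg_refine P \<gamma> (s n)" using eq by (simp add: sg_step_def)
      then have "idx (s n) = Suc k" using Suc.prems by (simp add: sg_refine_def)
      then obtain x h j where IH: "updates_at f X \<phi> s g k x h" "ell (s n) = int j"
        "epsprev (s n) = eps k" "xprev (s n) = x" "hprev (s n) = h"
        "alprev (s n) = lam k * (real_of_ereal (f x) - \<phi>) / (norm h)\<^sup>2"
        using Suc.IH n by blast
      have "\<gamma> powi (int j + 1) = \<gamma> ^ Suc j"
        by (metis add.commute of_nat_Suc power_int_of_nat)
      with IH s show ?thesis
        by (intro exI[of _ x] exI[of _ h] exI[of _ "Suc j"]) (simp add: sg_refine_def)
    next
      case False
      then have s: "s (Suc n) = sg_advance f P \<phi> lam eps (s n) (g n)"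
        using eq by (simp add: sg_step_def)
      then have k: "idx (s n) = k" using Suc.prems by (simp add: sg_advance_def Let_def)
      then have "updates_at f X \<phi> s g k (xcur (s n)) (g n)"
        unfolding updates_at_def using n False by blast
      with s k show ?thesis
        by (intro exI[of _ "xcur (s n)"] exI[of _ "g n"] exI[of _ 0])
           (simp add: sg_advance_def Let_def)
    qed
  qed
  then show ?thesis by metis
qed

text \<open>Refining only shrinks the accuracy, because \<gamma> is at most 1, so the bound
  \<open>eps k\<close> survives any number of refinements. Uniqueness identifies the predecessor
  with the given \<open>x\<close> and \<open>h\<close>.\<close>

lemma norm_update_diff_le:
  assumes run: "sg_run f X P \<phi> x0 lam eps \<gamma> s g" and P: "approx_projection X P"
    and \<gamma>: "0 \<le> \<gamma>" "\<gamma> \<le> 1" and eps: "0 \<le> eps k"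
    and u: "updates_at f X \<phi> s g k x h" "updates_at f X \<phi> s g (Suc k) x' h'"
  shows "norm (x' - closest_point X (x - (lam k * (real_of_ereal (f x) - \<phi>) / (norm h)\<^sup>2) *\<^sub>R h))
           \<le> eps k"
proof -
  obtain n where "reached f X \<phi> s g n" "idx (s n) = Suc k" "xcur (s n) = x'"
    using u(2) unfolding updates_at_def by blast
  with xcur_eq_projection[OF run] updates_at_unique[OF run u(1)]
  obtain j :: nat where "x' = P (\<gamma> ^ j * eps k)
       (x - (lam k * (real_of_ereal (f x) - \<phi>) / (norm h)\<^sup>2) *\<^sub>R h)"
    by metis
  moreover have "0 \<le> \<gamma> ^ j * eps k" "\<gamma> ^ j * eps k \<le> eps k"
    using \<gamma> eps by (auto simp: mult_left_le_one_le power_le_one)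
  ultimately show ?thesis
    using P unfolding approx_projection_def by (metis order_trans)
qed

lemma updates_at_D:
  assumes run: "sg_run f X P \<phi> x0 lam eps \<gamma> s g" and u: "updates_at f X \<phi> s g k x h"
  shows "f x < \<infinity>" "ereal \<phi> < f x" "h \<in> subdifferential f x"
  using assms unfolding updates_at_def sg_run_def at_target_def ext_dom_def by auto

text \<open>An update is not a stop, so the state after the update at the preceding index is
  reached, and it has index \<open>k\<close>.\<close>

lemma index_attained:
  assumes run: "sg_run f X P \<phi> x0 lam eps \<gamma> s g"
    and below: "\<And>j. j < k \<Longrightarrow> \<exists>x h. updates_at f X \<phi> s g j x h"
  shows "\<exists>n. reached f X \<phi> s g n \<and> idx (s n) = k"
proof (cases k)
  case 0
  then show ?thesis using run by (auto simp: sg_run_def sg_init_def reached_def intro!: exI[of _ 0])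
next
  case (Suc j)
  then obtain n where n: "reached f X \<phi> s g n" "idx (s n) = j" "\<not> at_target f \<phi> (xcur (s n)) (g n)"
    using below[of j] unfolding updates_at_def by blast
  then have S: "reached f X \<phi> s g (Suc n)" by (auto simp: reached_def sg_stops_def less_Suc_eq)
  then have "idx (s (Suc n)) = k" using sg_run_Suc[OF run S] n Suc by (simp add: idx_sg_step)
  with S show ?thesis by blast
qed

theorem theorem2:
  fixes f :: "real ^ 'n \<Rightarrow> ereal" and X :: "(real ^ 'n) set"
    and P :: "real \<Rightarrow> real ^ 'n \<Rightarrow> real ^ 'n"
    and \<phi> \<gamma> \<beta> Hlow Hup :: real
    and lam eps \<nu> :: "nat \<Rightarrow> real"
    and x0 :: "real ^ 'n"
    and s :: "nat \<Rightarrow> (real ^ 'n) sg_state" and g :: "nat \<Rightarrow> real ^ 'n"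
  assumes "ext_convex f"
    and "closed X" and "convex X" and "X \<subset> interior (ext_dom f)"
    and "argmin_on f X \<noteq> {}" and "bounded (argmin_on f X)"
    and "(INF x\<in>X. f x) \<le> ereal \<phi>"
    and "\<And>k. 0 < lam k" and "\<And>k. lam k \<le> \<beta>" and "\<beta> < 2"
    and "filterlim (\<lambda>m. \<Sum>k<m. lam k) at_top sequentially"
    and "\<And>k. 0 \<le> \<nu> k" and "summable \<nu>"
    and "0 < \<gamma>" and "\<gamma> < 1"
    and "approx_projection X P"
    and "sg_run f X P \<phi> x0 lam eps \<gamma> s g"
    and "0 < Hlow"
    and "\<And>n. reached f X \<phi> s g n \<Longrightarrow> Hlow \<le> norm (g n) \<and> norm (g n) \<le> Hup"
    and "\<And>k x h. updates_at f X \<phi> s g k x h \<Longrightarrow>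
           0 \<le> eps k \<and> eps k \<le> min (eps_bar f X \<phi> (lam k) x h) (\<nu> k)"
  shows "(\<forall>\<delta>>0. \<exists>K. iterates f X \<phi> s g K \<noteq> {} \<and>
            (\<forall>x\<in>iterates f X \<phi> s g K. f x \<le> ereal (\<phi> + \<delta>))) \<and>
         (\<forall>x h. (\<forall>k. updates_at f X \<phi> s g k (x k) (h k)) \<longrightarrow>
            (\<forall>k. f (x k) > ereal \<phi>) \<longrightarrow> lam \<longlonglongrightarrow> 0 \<longrightarrow>
            (\<lambda>k. f (x k)) \<longlonglongrightarrow> ereal \<phi>)"
proof -
  note run = assms(17)
  obtain z where z: "z \<in> argmin_on f X" using assms(5) by blast
  then have zX: "z \<in> X" and zmin: "\<And>y. y \<in> X \<Longrightarrow> f z \<le> f y"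
    by (auto simp: argmin_on_def is_arg_min_def not_less)
  have fz: "f z \<le> ereal \<phi>"
    by (rule order_trans[OF INF_greatest assms(7)]) (rule zmin)
  \<comment> \<open>Any infinite sequence of updates fits the abstract convergence lemmas, with gaps
    \<open>r\<close> that are real because \<open>f\<close> is finite at the iterates. Both claims
    use this.\<close>
  have gap: "summable (\<lambda>k. lam k * (real_of_ereal (f (x k)) - \<phi>)\<^sup>2)
      \<and> (lam \<longlonglongrightarrow> 0 \<longrightarrow> (\<lambda>k. real_of_ereal (f (x k)) - \<phi>) \<longlonglongrightarrow> 0)
      \<and> (\<forall>k. f (x k) = ereal (real_of_ereal (f (x k))))"
    if u: "\<And>k. updates_at f X \<phi> s g k (x k) (h k)" for x h
  proof -
    define r where "r k = real_of_ereal (f (x k)) - \<phi>" for k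
    have fx: "f (x k) = ereal (r k + \<phi>)" for k
      using updates_at_D[OF run u, of k] by (cases "f (x k)") (auto simp: r_def)
    have r0: "0 \<le> r k" for k using updates_at_D(2)[OF run u, of k] by (simp add: fx)
    have h: "Hlow \<le> norm (h k)" "norm (h k) \<le> Hup" for k
    proof -
      obtain n where "reached f X \<phi> s g n" "g n = h k"
        using u[of k] unfolding updates_at_def by blast
      then show "Hlow \<le> norm (h k)" "norm (h k) \<le> Hup" using assms(19)[of n] by auto
    qed
    have h0: "h k \<noteq> 0" for k using h(1)[of k] assms(18) by auto
    have subg: "ereal (r k + \<phi>) + ereal (h k \<bullet> (y - x k)) \<le> f y" for k y
      using updates_at_D(3)[OF run u, of k] by (simp add: subdifferential_def fx)
    have sub: "r k \<le> h k \<bullet> (x k - z)" for k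
      using order_trans[OF subg fz, of k] by (simp add: inner_diff_right)
    have sub_next: "r (Suc k) - r k \<le> h (Suc k) \<bullet> (x (Suc k) - x k)" for k
      using subg[of "Suc k" "x k"] by (simp add: fx inner_diff_right)
    have step: "norm (x (Suc k) - closest_point X (x k - (lam k * r k / (norm (h k))\<^sup>2) *\<^sub>R h k))
        \<le> \<nu> k" for k
      using norm_update_diff_le[OF run assms(16) _ _ _ u u, of k] assms(14,15) assms(20)[OF u, of k]
      by (simp add: r_def)
    note lam = less_imp_le[OF assms(8)] assms(9,10)
    have "summable (\<lambda>k. lam k * (r k)\<^sup>2)"
      using assms(2,3) zX step sub r0 lam assms(13) h0 h(2)
      by (rule summable_step_times_gap_squared[where x = x and h = h and r = r and lam = lam
            and \<nu> = \<nu>])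
    moreover have "r \<longlonglongrightarrow> 0" if "lam \<longlonglongrightarrow> 0"
      using assms(2,3) zX step sub sub_next r0 lam that assms(11,13,18) h
      by (rule projected_step_gap_tendsto_zero[where x = x and h = h and r = r and lam = lam
            and \<nu> = \<nu>])
    moreover have "f (x k) = ereal (real_of_ereal (f (x k)))" for k by (simp add: fx)
    ultimately show ?thesis unfolding r_def by blast
  qed
  \<comment> \<open>The positive lower bound \<open>Hlow\<close> rules out zero subgradients, so the
    target test can only succeed through the function value.\<close>
  have at_targetD: "f (xcur (s n)) \<le> ereal \<phi>"
    if "reached f X \<phi> s g n" "at_target f \<phi> (xcur (s n)) (g n)" for n
    using assms(18) assms(19)[OF that(1)] that(2) by (auto simp: at_target_def)
  have "\<exists>K. iterates f X \<phi> s g K \<noteq> {} \<and> (\<forall>x\<in>iterates f X \<phi> s g K. f x \<le> ereal (\<phi> + \<delta>))"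
    if \<delta>: "0 < \<delta>" for \<delta>
  proof -
    have \<phi>\<delta>: "f x \<le> ereal (\<phi> + \<delta>)" if "f x \<le> ereal \<phi>" for x
      using that \<delta> by (meson ereal_less_eq(3) less_add_same_cancel1 less_imp_le order_trans)
    \<comment> \<open>Either the run stops, or every index has an update, or some refinement phase
      never ends.\<close>
    consider (stop) k x where "stops_at f X \<phi> s g k x"
      | (upd) "\<And>k x. \<not> stops_at f X \<phi> s g k x" "\<And>k. \<exists>x h. updates_at f X \<phi> s g k x h"
      | (refine) k where "\<And>k x. \<not> stops_at f X \<phi> s g k x" "\<nexists>x h. updates_at f X \<phi> s g k x h"
      by blast
    then show ?thesis
    proof cases
      case stop
      have "f y \<le> ereal \<phi>" if "stops_at f X \<phi> s g k y" for y
        using that at_targetD by (auto simp: stops_at_def sg_stops_def)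
      then show ?thesis
        using stop not_updates_at_if_stops_at[OF run stop] \<phi>\<delta>
        by (intro exI[of _ k]) (auto simp: iterates_def Let_def)
    next
      case upd
      then obtain x h where u: "\<And>k. updates_at f X \<phi> s g k (x k) (h k)" by metis
      have "summable (\<lambda>k. lam k * (real_of_ereal (f (x k)) - \<phi>)\<^sup>2)" using gap[OF u] by (rule conjunct1)
      from frequently_small_of_summable_weighted_squares[OF assms(11) less_imp_le[OF assms(8)] this \<delta>]
      obtain K where K: "real_of_ereal (f (x K)) - \<phi> < \<delta>" by metis
      have "f (x K) = ereal (real_of_ereal (f (x K)))" using gap[OF u] by blast
      also have "\<dots> \<le> ereal (\<phi> + \<delta>)" using K by simp
      finally have "f (x K) \<le> ereal (\<phi> + \<delta>)" .
      moreover have "{y. stops_at f X \<phi> s g K y \<or> (\<exists>h. updates_at f X \<phi> s g K y h)} = {x K}"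
        using upd(1) u[of K] updates_at_unique[OF run _ u[of K]] by blast
      ultimately show ?thesis by (intro exI[of _ K]) (auto simp: iterates_def Let_def)
    next
      case refine
      \<comment> \<open>All indices below the least one without an update have updates, so
        \<open>K\<close> is attained. Every point examined there passes the target test.\<close>
      define K where "K = (LEAST k. \<nexists>x h. updates_at f X \<phi> s g k x h)"
      have K: "\<nexists>x h. updates_at f X \<phi> s g K x h"
        unfolding K_def using refine(2) by (rule LeastI)
      have "\<exists>n. reached f X \<phi> s g n \<and> idx (s n) = K"
      proof (rule index_attained[OF run])
        show "\<exists>x h. updates_at f X \<phi> s g j x h" if "j < K" for j
          using not_less_Least[OF that[unfolded K_def]] by blast
      qed
      moreover have "f (xcur (s n)) \<le> ereal \<phi>" if "reached f X \<phi> s g n" "idx (s n) = K" for n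
        using at_targetD[OF that(1)] K that by (auto simp: updates_at_def)
      moreover have "iterates f X \<phi> s g K = {xcur (s n) |n. reached f X \<phi> s g n \<and> idx (s n) = K}"
        using refine(1) K by (auto simp: iterates_def Let_def)
      ultimately show ?thesis using \<phi>\<delta> by (intro exI[of _ K]) auto
    qed
  qed
  moreover have "(\<lambda>k. f (x k)) \<longlonglongrightarrow> ereal \<phi>"
    if u: "\<forall>k. updates_at f X \<phi> s g k (x k) (h k)" and "lam \<longlonglongrightarrow> 0" for x h
  proof -
    have "(\<lambda>k. real_of_ereal (f (x k)) - \<phi>) \<longlonglongrightarrow> 0" using gap u that(2) by blast
    then have "(\<lambda>k. real_of_ereal (f (x k))) \<longlonglongrightarrow> \<phi>" by (simp add: LIM_zero_iff)
    then have "(\<lambda>k. ereal (real_of_ereal (f (x k)))) \<longlonglongrightarrow> ereal \<phi>" by simp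
    moreover have "ereal (real_of_ereal (f (x k))) = f (x k)" for k using gap u by metis
    ultimately show ?thesis by simp
  qed
  ultimately show ?thesis by blast
qed

end
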